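(* Let $\Gamma$ be a countable group acting on a set $X$. The action of $\Gamma$ on $X$ is amenable if and only if there is an $\varepsilon \in (0,1)$ such that for any finite set $S \subset \Gamma$ there exists a finite nonempty set $F \subset X$ such that $$\text{for any } \gamma \in S, \quad \frac{|\gamma F \cap F|}{|F|} > 1 - \varepsilon.$$
   Context: The action of a countable group $\Gamma$ on a set $X$ (on the left) is amenable if there is a linear functional $m : \ell^\infty(X) \to \mathbb{R}$ such that $m(\mathbf{1}) = 1$ (where $\mathbf{1}$ is the constant function $1$), $m(f) \geq 0$ whenever $f \geq 0$, and $m(\gamma \cdot f) = m(f)$ for every $\gamma \in \Gamma$ and $f \in \ell^\infty(X)$, where $(\gamma \cdot f)(x) = f(\gamma^{-1}x)$. *)

theory Defs
  imports "HOL-Analysis.Analysis" "HOL-Algebra.Group_Action"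
begin

text \<open>Real functions on a carrier set \<open>X\<close> are rendered as functions that are \<open>undefined\<close>
  outside \<open>X\<close> (\<^term>\<open>extensional X\<close>), so that equality of functions is equality on \<open>X\<close>.\<close>

definition ell_infty :: "'x set \<Rightarrow> ('x \<Rightarrow> real) set" where
  "ell_infty X = {f \<in> extensional X. bounded (f ` X)}"

text \<open>Linearity, for the pointwise operations on \<open>X\<close>; nothing is required of \<open>m\<close> outside
  \<^term>\<open>ell_infty X\<close>.\<close>

definition linear_functional_on_ell_infty :: "'x set \<Rightarrow> (('x \<Rightarrow> real) \<Rightarrow> real) \<Rightarrow> bool" where
  "linear_functional_on_ell_infty X m \<longleftrightarrow>
    (\<forall>f\<in>ell_infty X. \<forall>g\<in>ell_infty X. m (\<lambda>x\<in>X. f x + g x) = m f + m g) \<and>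
    (\<forall>c. \<forall>f\<in>ell_infty X. m (\<lambda>x\<in>X. c * f x) = c * m f)"

definition translate ::
  "('g, 'r) monoid_scheme \<Rightarrow> 'x set \<Rightarrow> ('g \<Rightarrow> 'x \<Rightarrow> 'x) \<Rightarrow> 'g \<Rightarrow> ('x \<Rightarrow> real) \<Rightarrow> 'x \<Rightarrow> real" where
  "translate G X \<phi> \<gamma> f = (\<lambda>x\<in>X. f (\<phi> (inv\<^bsub>G\<^esub> \<gamma>) x))"

definition amenable_action ::
  "('g, 'r) monoid_scheme \<Rightarrow> 'x set \<Rightarrow> ('g \<Rightarrow> 'x \<Rightarrow> 'x) \<Rightarrow> bool" where
  "amenable_action G X \<phi> \<longleftrightarrow>
    (\<exists>m. linear_functional_on_ell_infty X m \<and>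
         m (\<lambda>x\<in>X. 1) = 1 \<and>
         (\<forall>f\<in>ell_infty X. (\<forall>x\<in>X. 0 \<le> f x) \<longrightarrow> 0 \<le> m f) \<and>
         (\<forall>\<gamma>\<in>carrier G. \<forall>f\<in>ell_infty X. m (translate G X \<phi> \<gamma> f) = m f))"

end

theory Submission
  imports Defs
begin

text \<open>
  Suppose that for \<open>\<epsilon> = 1/2\<close> the condition fails for some \<open>S\<close>. Then \<open>S \<union> {1}\<close> enlarges every finite
  subset of \<open>X\<close> by the factor \<open>3/2\<close>, so the products of two of its elements enlarge it by a factor of
  at least \<open>2\<close>. Hall's marriage theorem turns this into two injections of \<open>X\<close> with disjoint ranges,
  both moving points piecewise by finitely many group elements; an invariant mean would then give
  \<open>X\<close> total mass at least \<open>2\<close>.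

  Conversely, let \<open>P\<close> be the averaging operator on \<open>\<ell>\<^sup>2(X)\<close> over a finite set \<open>T\<close> containing \<open>1\<close>, let
  \<open>v\<close> be the indicator function of a set \<open>F\<close> that works for all words of length \<open>N\<close> in \<open>T\<close>, and put
  \<open>b\<^sub>m = \<parallel>P\<^sup>m v\<parallel>\<^sup>2\<close>. The inner product of \<open>P\<^sup>N v\<close> and \<open>v\<close> is at least \<open>(1 - \<epsilon>) \<parallel>v\<parallel>\<^sup>2\<close>, so the decreasing
  numbers \<open>b\<^sub>0, \<dots>, b\<^sub>N\<close> stay above \<open>(1 - \<epsilon>)\<^sup>2 b\<^sub>0\<close>, and some \<open>b\<^sub>m - b\<^sub>m\<^sub>+\<^sub>1\<close> is at most \<open>b\<^sub>0 / N\<close>. This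
  difference is the mean square distance from the translates of \<open>w = P\<^sup>m v\<close> to \<open>P w\<close>, so \<open>w\<close> is almost
  invariant, and \<open>w\<^sup>2 / \<parallel>w\<parallel>\<^sup>2\<close> is an almost invariant probability density. A limit point of such densities
  is an invariant mean.
\<close>

section \<open>Hall's marriage theorem for families of finite sets\<close>

text \<open>Rado's argument: by Zorn's lemma thin out the family as far as Hall's condition permits. If two
  elements could be removed from the same set, submodularity of \<open>J \<mapsto> card (R `` J)\<close> would contradict
  minimality, so all sets of a minimal family are singletons.\<close>

lemma Hall_representatives:
  assumes fin: "\<And>i. i \<in> I \<Longrightarrow> finite (A i)"
    and hall: "\<And>J. finite J \<Longrightarrow> J \<subseteq> I \<Longrightarrow> card J \<le> card (\<Union>(A ` J))"
  obtains f where "inj_on f I" "\<And>i. i \<in> I \<Longrightarrow> f i \<in> A i"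
proof -
  \<comment> \<open>\<open>D\<close> records the pairs removed so far, so Zorn's lemma is applied
    upwards and a maximal \<open>D\<close> leaves a minimal family.\<close>
  define good where "good D \<longleftrightarrow> D \<subseteq> Sigma I A \<and>
    (\<forall>J. finite J \<and> J \<subseteq> I \<longrightarrow> card J \<le> card ((Sigma I A - D) `` J))" for D
  have "\<exists>M\<in>Collect good. \<forall>D\<in>Collect good. M \<subseteq> D \<longrightarrow> D = M"
  proof (rule subset_Zorn')
    fix C assume chain: "subset.chain (Collect good) C"
    then have sub: "C \<subseteq> Collect good" by (simp add: subset.chain_def)
    have "card J \<le> card ((Sigma I A - \<Union>C) `` J)" if J: "finite J" "J \<subseteq> I" for J
    proof (cases "C = {}")
      case True
      moreover have "Sigma I A `` J = \<Union>(A ` J)" using J by auto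
      ultimately show ?thesis using hall J by simp
    next
      case False
      \<comment> \<open>Here finiteness of the sets matters: only finitely many pairs lie over
        \<open>J\<close>, so one member of the chain already removes all of those that
        \<open>\<Union>C\<close> removes.\<close>
      have "finite (Sigma J A)" using J fin by blast
      then obtain D where D: "D \<in> C" "\<Union>C \<inter> Sigma J A \<subseteq> D"
        using finite_subset_Union_chain[of "\<Union>C \<inter> Sigma J A" C] False chain
        by (metis finite_Int inf_le1)
      then have "(Sigma I A - \<Union>C) `` J = (Sigma I A - D) `` J" using J by blast
      then show ?thesis using D sub J unfolding good_def by auto
    qed
    moreover have "\<Union>C \<subseteq> Sigma I A" using sub unfolding good_def by blast
    ultimately show "\<Union>C \<in> Collect good" by (simp add: good_def)
  qed
  then obtain M where M: "good M" and max: "\<And>D. good D \<Longrightarrow> M \<subseteq> D \<Longrightarrow> D = M" by blast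
  define R where "R = Sigma I A - M"
  have R: "card J \<le> card (R `` J)" if "finite J" "J \<subseteq> I" for J
    using M that unfolding good_def R_def by blast
  have finR: "finite (R `` J)" if "finite J" "J \<subseteq> I" for J
    by (rule finite_subset[of _ "\<Union>(A ` J)"]) (use that fin in \<open>auto simp: R_def\<close>)
  \<comment> \<open>By maximality, removing \<open>(i, x)\<close> as well breaks Hall's condition at
    some finite set containing \<open>i\<close>; dropping \<open>i\<close> from that set turns the
    strict inequality into \<open>\<le>\<close>.\<close>
  have tight: "\<exists>J. finite J \<and> J \<subseteq> I - {i} \<and> card (R `` J \<union> (R `` {i} - {x})) \<le> card J"
    if ix: "(i, x) \<in> R" for i x
  proof -
    have "\<not> good (insert (i, x) M)" using max[of "insert (i, x) M"] ix unfolding R_def by blast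
    moreover have "Sigma I A - insert (i, x) M = R - {(i, x)}" unfolding R_def by blast
    ultimately obtain J where J: "finite J" "J \<subseteq> I" "card ((R - {(i, x)}) `` J) < card J"
      using M ix unfolding good_def R_def by (auto simp: not_le)
    have "i \<in> J"
    proof (rule ccontr)
      assume "i \<notin> J"
      then have "(R - {(i, x)}) `` J = R `` J" by blast
      then show False using J R by fastforce
    qed
    then have "(R - {(i, x)}) `` J = R `` (J - {i}) \<union> (R `` {i} - {x})" by blast
    then show ?thesis using J \<open>i \<in> J\<close> by (intro exI[of _ "J - {i}"]) auto
  qed
  have uniq: "x = y" if ix: "(i, x) \<in> R" and iy: "(i, y) \<in> R" for i x y
  proof (rule ccontr)
    assume "x \<noteq> y"
    obtain J where J: "finite J" "J \<subseteq> I - {i}" "card (R `` J \<union> (R `` {i} - {x})) \<le> card J"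
      using tight[OF ix] by blast
    obtain K where K: "finite K" "K \<subseteq> I - {i}" "card (R `` K \<union> (R `` {i} - {y})) \<le> card K"
      using tight[OF iy] by blast
    let ?U = "R `` J \<union> (R `` {i} - {x})" and ?V = "R `` K \<union> (R `` {i} - {y})"
    have i: "i \<in> I" using ix unfolding R_def by blast
    have fin': "finite ?U" "finite ?V" using J K finR[of J] finR[of K] finR[of "{i}"] i by auto
    \<comment> \<open>As \<open>x\<close> and \<open>y\<close> differ, each survives in one of
      \<open>?U\<close> and \<open>?V\<close>, so their union misses nothing. The 1 counted for
      \<open>i\<close> is what contradicts submodularity.\<close>
    have "card (J \<union> K) + 1 = card (insert i (J \<union> K))" using J K by (subst card_insert_disjoint) auto
    also have "\<dots> \<le> card (R `` insert i (J \<union> K))" using J K i by (intro R) auto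
    also have "R `` insert i (J \<union> K) = ?U \<union> ?V" using \<open>x \<noteq> y\<close> by blast
    finally have 1: "card (J \<union> K) + 1 \<le> card (?U \<union> ?V)" .
    have "card (J \<inter> K) \<le> card (R `` (J \<inter> K))" using J by (intro R) auto
    also have "\<dots> \<le> card (?U \<inter> ?V)" using fin' by (intro card_mono) auto
    finally have "card (J \<union> K) + 1 + card (J \<inter> K) \<le> card ?U + card ?V"
      using 1 card_Un_Int[OF fin'] by linarith
    then show False using J K card_Un_Int[of J K] by linarith
  qed
  have "\<exists>x. (i, x) \<in> R" if "i \<in> I" for i
    using R[of "{i}"] that by (cases "R `` {i} = {}") auto
  then obtain f where f: "\<And>i. i \<in> I \<Longrightarrow> (i, f i) \<in> R" by metis
  have "inj_on f I"
  proof (rule inj_onI, rule ccontr)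
    fix i j assume ij: "i \<in> I" "j \<in> I" "f i = f j" "i \<noteq> j"
    have "R `` {i, j} \<subseteq> {f i}"
    proof
      fix y assume "y \<in> R `` {i, j}"
      then show "y \<in> {f i}" using uniq[OF f[OF ij(1)]] uniq[OF f[OF ij(2)]] ij(3) by auto
    qed
    then have "card (R `` {i, j}) \<le> card {f i}" by (rule card_mono[rotated]) simp
    then show False using R[of "{i, j}"] ij by auto
  qed
  then show ?thesis using f that unfolding R_def by blast
qed

section \<open>From an invariant mean to Folner sets\<close>

context group_action begin

lemma act_closed: "g \<in> carrier G \<Longrightarrow> x \<in> E \<Longrightarrow> \<phi> g x \<in> E"
  using element_image by blast

lemma act_bij: "g \<in> carrier G \<Longrightarrow> bij_betw (\<phi> g) E E"
  by (simp add: bij_betw_def inj_prop surj_prop)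

lemma act_card: "g \<in> carrier G \<Longrightarrow> F \<subseteq> E \<Longrightarrow> card (\<phi> g ` F) = card F"
  using inj_on_subset[OF inj_prop] by (intro card_image) auto

text \<open>Pointwise form of the fact that translating the indicator function of \<open>A\<close>
  by \<open>g\<close> gives the indicator function of the image of \<open>A\<close>.\<close>

lemma act_mem_iff:
  assumes g: "g \<in> carrier G" and x: "x \<in> E" and A: "A \<subseteq> E"
  shows "\<phi> (inv\<^bsub>G\<^esub> g) x \<in> A \<longleftrightarrow> x \<in> \<phi> g ` A"
proof -
  interpret grp: group G using group_hom group_hom.axioms(1) by blast
  have "\<phi> g (\<phi> (inv\<^bsub>G\<^esub> g) x) = x"
    by (metis composition_rule g grp.inv_closed grp.r_inv id_eq_one restrict_apply' x)
  moreover have "\<phi> (inv\<^bsub>G\<^esub> g) (\<phi> g y) = y" if "y \<in> A" for y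
    using orbit_sym_aux[OF g _ refl] that A by blast
  ultimately show ?thesis by (auto intro: rev_image_eqI)
qed

lemma Folner_if_amenable:
  assumes amen: "amenable_action G E \<phi>" and S: "finite S" "S \<subseteq> carrier G"
  shows "\<exists>F. finite F \<and> F \<noteq> {} \<and> F \<subseteq> E \<and>
    (\<forall>\<gamma>\<in>S. real (card (\<phi> \<gamma> ` F \<inter> F)) / real (card F) > 1 / 2)"
proof (rule ccontr)
  assume no: "\<not> ?thesis"
  interpret grp: group G using group_hom group_hom.axioms(1) by blast
  define T where "T = insert \<one>\<^bsub>G\<^esub> S"
  have T: "finite T" "T \<subseteq> carrier G" using S by (auto simp: T_def)
  define sat where "sat F = (\<Union>t\<in>T. \<phi> t ` F)" for F
  have sat: "finite (sat F)" "sat F \<subseteq> E" if "finite F" "F \<subseteq> E" for F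
    using T that by (auto simp: sat_def intro!: act_closed)
  \<comment> \<open>Some \<open>g\<close> in \<open>S\<close> moves at least half of
    \<open>F\<close> out of \<open>F\<close>, which adds \<open>card F / 2\<close> new points; the
    unit in \<open>T\<close> keeps \<open>F\<close> itself inside \<open>sat F\<close>.\<close>
  have grow: "3 * card F \<le> 2 * card (sat F)" if F: "finite F" "F \<subseteq> E" for F
  proof (cases "F = {}")
    case False
    then have "\<not> (\<forall>\<gamma>\<in>S. real (card (\<phi> \<gamma> ` F \<inter> F)) / real (card F) > 1 / 2)"
      using no F by blast
    then obtain g where g: "g \<in> S" "real (card (\<phi> g ` F \<inter> F)) / real (card F) \<le> 1 / 2"
      unfolding not_less[symmetric] by blast
    then have "2 * card (\<phi> g ` F \<inter> F) \<le> card F"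
      using F False by (simp add: field_simps card_gt_0_iff split: if_splits)
    moreover have "card (\<phi> g ` F) + card F = card (\<phi> g ` F \<union> F) + card (\<phi> g ` F \<inter> F)"
      using F by (intro card_Un_Int) auto
    moreover have "card (\<phi> g ` F) = card F" using act_card g S F by blast
    moreover have "card (\<phi> g ` F \<union> F) \<le> card (sat F)"
    proof (rule card_mono[OF sat(1)[OF F]])
      have "\<phi> \<one>\<^bsub>G\<^esub> ` F = F" using F by (auto simp: id_eq_one[symmetric])
      then show "\<phi> g ` F \<union> F \<subseteq> sat F" using g by (auto simp: sat_def T_def)
    qed
    ultimately show ?thesis by linarith
  qed simp
  \<comment> \<open>Two rounds suffice, as (3/2)^2 = 9/4 exceeds 2.\<close>
  have double: "2 * card F \<le> card (sat (sat F))" if "finite F" "F \<subseteq> E" for F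
    using grow[OF that] grow[OF sat[OF that]] by linarith
  define U where "U = (\<lambda>(s, t). s \<otimes>\<^bsub>G\<^esub> t) ` (T \<times> T)"
  have U: "finite U" "U \<subseteq> carrier G" using T by (auto simp: U_def)
  have sat2: "sat (sat F) = (\<Union>x\<in>F. (\<lambda>u. \<phi> u x) ` U)" if "F \<subseteq> E" for F
    using T that by (fastforce simp: sat_def U_def composition_rule image_iff subset_iff)
  \<comment> \<open>Each point occurs with both labels from \<open>bool\<close>, so one system of
    representatives encodes two injections with disjoint ranges.\<close>
  obtain \<psi> where inj: "inj_on \<psi> (E \<times> (UNIV :: bool set))"
    and \<psi>: "\<And>i. i \<in> E \<times> UNIV \<Longrightarrow> \<psi> i \<in> (\<lambda>u. \<phi> u (fst i)) ` U"
  proof (rule Hall_representatives[of "E \<times> (UNIV :: bool set)" "\<lambda>i. (\<lambda>u. \<phi> u (fst i)) ` U"])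
    fix J :: "('c \<times> bool) set" assume J: "finite J" "J \<subseteq> E \<times> UNIV"
    have "card J \<le> card (fst ` J \<times> (UNIV :: bool set))"
      using J by (intro card_mono) (auto intro: rev_image_eqI)
    also have "\<dots> = 2 * card (fst ` J)" by (simp add: card_cartesian_product)
    also have "\<dots> \<le> card (sat (sat (fst ` J)))" using J by (intro double) auto
    also have "sat (sat (fst ` J)) = (\<Union>i\<in>J. (\<lambda>u. \<phi> u (fst i)) ` U)"
      using J by (subst sat2) auto
    finally show "card J \<le> card (\<Union>i\<in>J. (\<lambda>u. \<phi> u (fst i)) ` U)" .
  qed (use U in auto)
  from \<psi> have "\<forall>i\<in>E \<times> UNIV. \<exists>u\<in>U. \<psi> i = \<phi> u (fst i)" by blast
  then obtain \<sigma> where \<sigma>: "\<And>i. i \<in> E \<times> UNIV \<Longrightarrow> \<sigma> i \<in> U \<and> \<psi> i = \<phi> (\<sigma> i) (fst i)" by metis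
  \<comment> \<open>\<open>A (u, b)\<close> is the piece of \<open>E\<close> that the injection
    labelled \<open>b\<close> moves by \<open>u\<close>, and \<open>B (u, b)\<close> is where it
    lands.\<close>
  define A where "A = (\<lambda>(u, b). {x\<in>E. \<sigma> (x, b) = u})"
  define B where "B = (\<lambda>(u, b :: bool). \<phi> u ` A (u, b))"
  have AE: "A p \<subseteq> E" for p by (cases p) (auto simp: A_def)
  have disjB: "B p \<inter> B q = {}" if "p \<noteq> q" for p q
  proof (rule ccontr)
    obtain u b u' b' where pq: "p = (u, b)" "q = (u', b')" by fastforce
    assume "B p \<inter> B q \<noteq> {}"
    then obtain x y where "x \<in> A p" "y \<in> A q" "\<phi> u x = \<phi> u' y"
      unfolding B_def pq by auto
    then have "x \<in> E" "y \<in> E" "\<sigma> (x, b) = u" "\<sigma> (y, b') = u'" "\<psi> (x, b) = \<psi> (y, b')"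
      using \<sigma>[of "(x, b)"] \<sigma>[of "(y, b')"] unfolding A_def pq by auto
    then show False using inj_onD[OF inj, of "(x, b)" "(y, b')"] that pq by auto
  qed
  obtain m where lin: "linear_functional_on_ell_infty E m" and one: "m (\<lambda>x\<in>E. 1) = 1"
    and pos: "\<And>f. f \<in> ell_infty E \<Longrightarrow> (\<forall>x\<in>E. 0 \<le> f x) \<Longrightarrow> 0 \<le> m f"
    and inv: "\<And>g f. g \<in> carrier G \<Longrightarrow> f \<in> ell_infty E \<Longrightarrow> m (translate G E \<phi> g f) = m f"
    using amen unfolding amenable_action_def by blast
  \<comment> \<open>Restricted to indicator functions, the mean becomes a finitely additive
    invariant probability measure \<open>\<mu>\<close> on the subsets of \<open>E\<close>.\<close>
  define ind :: "'c set \<Rightarrow> 'c \<Rightarrow> real" where "ind A = (\<lambda>x\<in>E. indicator A x)" for A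
  define \<mu> where "\<mu> A = m (ind A)" for A
  have ind: "ind A \<in> ell_infty E" for A
    unfolding ell_infty_def ind_def
    by (auto intro!: boundedI[of _ 1] simp: indicator_def)
  have \<mu>_pos: "0 \<le> \<mu> A" for A using pos[OF ind] by (simp add: \<mu>_def ind_def)
  have \<mu>_E: "\<mu> E = 1"
  proof -
    have "ind E = (\<lambda>x\<in>E. 1)" by (auto simp: ind_def fun_eq_iff)
    then show ?thesis using one by (simp add: \<mu>_def)
  qed
  have \<mu>_Un: "\<mu> (A \<union> B) = \<mu> A + \<mu> B" if "A \<inter> B = {}" for A B
  proof -
    have "ind (A \<union> B) = (\<lambda>x\<in>E. ind A x + ind B x)"
      using that by (auto simp: ind_def indicator_def fun_eq_iff)
    then show ?thesis
      using lin ind unfolding linear_functional_on_ell_infty_def \<mu>_def by simp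
  qed
  have \<mu>_empty: "\<mu> {} = 0" using \<mu>_Un[of "{}" "{}"] by simp
  have \<mu>_UN: "\<mu> (\<Union>(C ` I)) = (\<Sum>i\<in>I. \<mu> (C i))"
    if "finite I" "\<And>i j. i \<in> I \<Longrightarrow> j \<in> I \<Longrightarrow> i \<noteq> j \<Longrightarrow> C i \<inter> C j = {}"
    for I and C :: "'a \<times> bool \<Rightarrow> 'c set"
    using that
  proof (induction I rule: finite_induct)
    case (insert i I)
    have "C i \<inter> \<Union>(C ` I) = {}" using insert.prems insert.hyps by blast
    then show ?case using insert by (simp add: \<mu>_Un)
  qed (simp add: \<mu>_empty)
  have \<mu>_act: "\<mu> (\<phi> g ` A) = \<mu> A" if g: "g \<in> carrier G" and A: "A \<subseteq> E" for g A
  proof -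
    have "translate G E \<phi> g (ind A) = ind (\<phi> g ` A)"
      using act_mem_iff[OF g _ A] act_closed[of "inv\<^bsub>G\<^esub> g"] g
      by (auto simp: translate_def ind_def indicator_def fun_eq_iff)
    then show ?thesis using inv[OF g ind, of A] by (simp add: \<mu>_def)
  qed
  have row: "(\<Sum>u\<in>U. \<mu> (A (u, b))) = 1" for b
  proof -
    have "\<Union>(A ` (U \<times> {b})) = E" using \<sigma> by (auto simp: A_def)
    then have "1 = (\<Sum>p\<in>U \<times> {b}. \<mu> (A p))"
      using \<mu>_E \<mu>_UN[of "U \<times> {b}" A] U by (auto simp: A_def)
    then show ?thesis by (simp add: sum.cartesian_product' U)
  qed
  \<comment> \<open>The pieces cover \<open>E\<close> once for each label, while their images have
    the same masses and are disjoint in \<open>E\<close>.\<close>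
  have "2 = (\<Sum>u\<in>U. \<Sum>b\<in>UNIV. \<mu> (A (u, b)))" by (subst sum.swap) (simp add: row)
  also have "\<dots> = (\<Sum>p\<in>U \<times> UNIV. \<mu> (A p))" by (simp add: sum.cartesian_product' U)
  also have "\<dots> = (\<Sum>p\<in>U \<times> UNIV. \<mu> (B p))"
  proof (rule sum.cong[OF refl])
    fix p assume p: "p \<in> U \<times> (UNIV :: bool set)"
    then show "\<mu> (A p) = \<mu> (B p)"
      using AE[of p] U by (cases p) (auto simp: B_def intro!: \<mu>_act[symmetric])
  qed
  also have "\<dots> = \<mu> (\<Union>(B ` (U \<times> UNIV)))" using disjB U by (intro \<mu>_UN[symmetric]) auto
  also have "\<dots> \<le> 1"
  proof -
    let ?W = "\<Union>(B ` (U \<times> UNIV))"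
    have "B p \<subseteq> E" if "p \<in> U \<times> UNIV" for p
      using that U AE[of p] by (cases p) (auto simp: B_def intro!: act_closed)
    then have "?W \<subseteq> E" by blast
    then have "\<mu> E = \<mu> ?W + \<mu> (E - ?W)" using \<mu>_Un[of ?W "E - ?W"] by (simp add: Un_absorb1)
    then show ?thesis using \<mu>_E \<mu>_pos[of "E - ?W"] by linarith
  qed
  finally show False by simp
qed
end

section \<open>Finitely supported functions and square sums\<close>

definition finsupp :: "'x set \<Rightarrow> ('x \<Rightarrow> real) \<Rightarrow> bool" where
  "finsupp E f \<longleftrightarrow> finite {x\<in>E. f x \<noteq> 0}"

text \<open>\<open>infsum\<close> defaults to 0 on families that are not summable, so
  \<open>finsupp\<close> is carried along wherever such sums are split or compared.\<close>

definition l2sq :: "'x set \<Rightarrow> ('x \<Rightarrow> real) \<Rightarrow> real" where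
  "l2sq E w = (\<Sum>\<^sub>\<infinity>x\<in>E. (w x)\<^sup>2)"

lemma finsupp_summable: "finsupp E f \<Longrightarrow> f summable_on E"
  unfolding finsupp_def by (rule finite_nonzero_values_imp_summable_on)

lemma finsupp_combine:
  assumes "finsupp E u" "finsupp E v" "\<And>x. x \<in> E \<Longrightarrow> u x = 0 \<Longrightarrow> v x = 0 \<Longrightarrow> w x = 0"
  shows "finsupp E w"
  unfolding finsupp_def
  by (rule finite_subset[of _ "{x\<in>E. u x \<noteq> 0} \<union> {x\<in>E. v x \<noteq> 0}"])
    (use assms in \<open>auto simp: finsupp_def\<close>)

lemma finsupp_mono:
  assumes "finsupp E u" "\<And>x. x \<in> E \<Longrightarrow> u x = 0 \<Longrightarrow> w x = 0"
  shows "finsupp E w"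
  using finsupp_combine[OF assms(1) assms(1), of w] assms(2) by blast

lemma finsupp_sum:
  assumes "finite T" "\<And>t. t \<in> T \<Longrightarrow> finsupp E (f t)"
  shows "finsupp E (\<lambda>x. \<Sum>t\<in>T. f t x)"
  using assms
proof (induction T rule: finite_induct)
  case (insert t T)
  then show ?case
    by (auto intro: finsupp_combine[of E "f t" "\<lambda>x. \<Sum>t\<in>T. f t x"])
qed (simp add: finsupp_def)

lemma infsum_sum_finsupp:
  assumes "finite T" "\<And>t. t \<in> T \<Longrightarrow> finsupp E (f t)"
  shows "(\<Sum>\<^sub>\<infinity>x\<in>E. \<Sum>t\<in>T. f t x) = (\<Sum>t\<in>T. infsum (f t) E)"
  using assms
proof (induction T rule: finite_induct)
  case (insert t T)
  then have "finsupp E (f t)" "finsupp E (\<lambda>x. \<Sum>t\<in>T. f t x)" by (auto intro: finsupp_sum)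
  then show ?case using insert by (simp add: infsum_add finsupp_summable)
qed simp

lemma finsupp_reindex:
  assumes "bij_betw s E E" "finsupp E f"
  shows "finsupp E (\<lambda>x. f (s x))"
proof -
  have "finite (s -` {x\<in>E. f x \<noteq> 0} \<inter> E)"
    using assms by (intro finite_vimage_IntI) (auto simp: finsupp_def bij_betw_def)
  moreover have "{x\<in>E. f (s x) \<noteq> 0} = s -` {x\<in>E. f x \<noteq> 0} \<inter> E"
    using assms(1) by (auto simp: bij_betw_def)
  ultimately show ?thesis by (simp add: finsupp_def)
qed

lemma l2sq_nonneg: "0 \<le> l2sq E w"
  by (simp add: l2sq_def infsum_nonneg)

lemma l2sq_reindex: "bij_betw s E E \<Longrightarrow> l2sq E (\<lambda>x. w (s x)) = l2sq E w"
  unfolding l2sq_def by (rule infsum_reindex_bij_betw)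

lemma finsupp_power2: "finsupp E w \<Longrightarrow> finsupp E (\<lambda>x. (w x)\<^sup>2)"
  by (erule finsupp_mono) simp

lemma sum_le_l2sq:
  assumes "finsupp E w" "finite F" "F \<subseteq> E"
  shows "(\<Sum>x\<in>F. (w x)\<^sup>2) \<le> l2sq E w"
  using assms finsupp_summable[OF finsupp_power2[OF assms(1)]]
    infsum_mono2[of "\<lambda>x. (w x)\<^sup>2" F E] by (simp add: l2sq_def)

text \<open>The variance identity. The negative coefficient keeps the right-hand side a sum, so that
  \<open>infsum_add\<close> fits it later.\<close>

lemma sum_power2_deviation:
  fixes a :: "'t \<Rightarrow> real"
  assumes "finite T" "T \<noteq> {}"
  defines "M \<equiv> (\<Sum>t\<in>T. a t) / card T"
  shows "(\<Sum>t\<in>T. (a t - M)\<^sup>2) = (\<Sum>t\<in>T. (a t)\<^sup>2) + (- real (card T)) * M\<^sup>2"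
proof -
  have M: "(\<Sum>t\<in>T. a t) = card T * M" using assms by (simp add: M_def)
  have "(\<Sum>t\<in>T. (a t - M)\<^sup>2) = (\<Sum>t\<in>T. (a t)\<^sup>2 + M\<^sup>2 - 2 * M * a t)"
    by (intro sum.cong) (auto simp: power2_diff)
  also have "\<dots> = (\<Sum>t\<in>T. (a t)\<^sup>2) + card T * M\<^sup>2 - 2 * M * (\<Sum>t\<in>T. a t)"
    by (simp add: sum.distrib sum_subtractf sum_distrib_left)
  finally show ?thesis unfolding M by (simp add: power2_eq_square)
qed

text \<open>Factor the difference of squares and apply the inequality of arithmetic and geometric
  means, weighted by \<open>d\<close>. Summed over \<open>E\<close>, this takes the place of the
  Cauchy-Schwarz inequality.\<close>

lemma abs_diff_power2_le:
  fixes p q d :: real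
  assumes d: "0 < d"
  shows "\<bar>p\<^sup>2 - q\<^sup>2\<bar> \<le> inverse (2 * d) * (p - q)\<^sup>2 + (d * p\<^sup>2 + d * q\<^sup>2)"
proof -
  have "p\<^sup>2 - q\<^sup>2 = (p - q) * (p + q)" by (simp add: power2_eq_square algebra_simps)
  then have "2 * d * \<bar>p\<^sup>2 - q\<^sup>2\<bar> = 2 * \<bar>p - q\<bar> * (d * \<bar>p + q\<bar>)"
    by (simp only: abs_mult mult_ac)
  also have "\<dots> \<le> \<bar>p - q\<bar>\<^sup>2 + (d * \<bar>p + q\<bar>)\<^sup>2" by (rule sum_squares_bound)
  also have "\<dots> = (p - q)\<^sup>2 + d\<^sup>2 * (p + q)\<^sup>2" by (simp add: power_mult_distrib)
  also have "\<dots> \<le> (p - q)\<^sup>2 + d\<^sup>2 * (2 * p\<^sup>2 + 2 * q\<^sup>2)"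
  proof -
    have "(p + q)\<^sup>2 \<le> 2 * p\<^sup>2 + 2 * q\<^sup>2"
      using zero_le_power2[of "p - q"] by (simp add: power2_eq_square algebra_simps)
    then show ?thesis by (simp add: mult_left_mono)
  qed
  also have "\<dots> = 2 * d * (inverse (2 * d) * (p - q)\<^sup>2 + (d * p\<^sup>2 + d * q\<^sup>2))"
    using d by (simp add: distrib_left power2_eq_square)
  finally show ?thesis using d by simp
qed

section \<open>Averaging operators and almost invariant densities\<close>

context group_action begin

text \<open>Precomposition with \<open>\<phi> t\<close> is translation by the inverse of
  \<open>t\<close>, so the translates averaged here are those by the inverses of
  \<open>T\<close>.\<close>

definition avg :: "'a set \<Rightarrow> ('c \<Rightarrow> real) \<Rightarrow> 'c \<Rightarrow> real" where
  "avg T w x = (\<Sum>t\<in>T. w (\<phi> t x)) / card T"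

lemma finsupp_act: "g \<in> carrier G \<Longrightarrow> finsupp E w \<Longrightarrow> finsupp E (\<lambda>x. w (\<phi> g x))"
  by (rule finsupp_reindex[OF act_bij])

lemma finsupp_avg:
  assumes "finite T" "T \<subseteq> carrier G" "finsupp E w"
  shows "finsupp E (avg T w)"
proof -
  have "finsupp E (\<lambda>x. \<Sum>t\<in>T. w (\<phi> t x))"
    using assms by (intro finsupp_sum finsupp_act) auto
  then show ?thesis by (rule finsupp_mono) (simp add: avg_def)
qed

text \<open>The variance identity for the numbers \<open>w (\<phi> t x)\<close>, summed over
  \<open>x\<close>; every translate of \<open>w\<close> has the same square sum as
  \<open>w\<close>.\<close>

lemma l2sq_avg_deviation:
  assumes T: "finite T" "T \<noteq> {}" "T \<subseteq> carrier G" and w: "finsupp E w"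
  shows "(\<Sum>t\<in>T. l2sq E (\<lambda>x. w (\<phi> t x) - avg T w x)) = card T * (l2sq E w - l2sq E (avg T w))"
proof -
  have fw: "finsupp E (\<lambda>x. w (\<phi> t x))" if "t \<in> T" for t
    using that T w by (intro finsupp_act) auto
  have fa: "finsupp E (avg T w)" using T w by (intro finsupp_avg)
  have fd: "finsupp E (\<lambda>x. w (\<phi> t x) - avg T w x)" if "t \<in> T" for t
    by (rule finsupp_combine[OF fw[OF that] fa]) simp
  have s1: "(\<lambda>x. \<Sum>t\<in>T. (w (\<phi> t x))\<^sup>2) summable_on E"
    using T fw by (intro finsupp_summable finsupp_sum finsupp_power2)
  have s2: "(\<lambda>x. (avg T w x)\<^sup>2) summable_on E"
    using fa by (intro finsupp_summable finsupp_power2)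
  have "(\<Sum>t\<in>T. l2sq E (\<lambda>x. w (\<phi> t x) - avg T w x))
      = (\<Sum>\<^sub>\<infinity>x\<in>E. \<Sum>t\<in>T. (w (\<phi> t x) - avg T w x)\<^sup>2)"
    unfolding l2sq_def using T fd by (intro infsum_sum_finsupp[symmetric] finsupp_power2)
  also have "\<dots> = (\<Sum>\<^sub>\<infinity>x\<in>E. (\<Sum>t\<in>T. (w (\<phi> t x))\<^sup>2) + (- real (card T)) * (avg T w x)\<^sup>2)"
    unfolding avg_def sum_power2_deviation[OF T(1,2)] ..
  also have "\<dots> = (\<Sum>\<^sub>\<infinity>x\<in>E. \<Sum>t\<in>T. (w (\<phi> t x))\<^sup>2) + (- real (card T)) * l2sq E (avg T w)"
    unfolding l2sq_def infsum_cmult_right'[symmetric]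
    by (intro infsum_add s1 summable_on_cmult_right s2)
  also have "(\<Sum>\<^sub>\<infinity>x\<in>E. \<Sum>t\<in>T. (w (\<phi> t x))\<^sup>2) = (\<Sum>t\<in>T. l2sq E (\<lambda>x. w (\<phi> t x)))"
    unfolding l2sq_def using T fw by (intro infsum_sum_finsupp finsupp_power2)
  also have "\<dots> = (\<Sum>t\<in>T. l2sq E w)"
    using T by (intro sum.cong refl l2sq_reindex act_bij) auto
  finally show ?thesis by (simp add: algebra_simps)
qed

text \<open>The set \<open>W\<close> consists of the words of length \<open>N\<close> in \<open>T\<close>.\<close>

lemma funpow_avg_lower_bound:
  assumes T: "finite T" "T \<noteq> {}" "T \<subseteq> carrier G"
  shows "\<exists>W. finite W \<and> W \<subseteq> carrier G \<and> (\<forall>F u a. F \<subseteq> E \<longrightarrow>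
    (\<forall>g\<in>W. a \<le> (\<Sum>x\<in>F. u (\<phi> g x))) \<longrightarrow> a \<le> (\<Sum>x\<in>F. (avg T ^^ N) u x))"
proof (induction N)
  case 0
  interpret grp: group G using group_hom group_hom.axioms(1) by blast
  have "(\<Sum>x\<in>F. u (\<phi> \<one>\<^bsub>G\<^esub> x)) = (\<Sum>x\<in>F. u x)" if "F \<subseteq> E" for F and u :: "'c \<Rightarrow> real"
    using that by (intro sum.cong) (auto simp: id_eq_one[symmetric])
  then show ?case by (intro exI[of _ "{\<one>\<^bsub>G\<^esub>}"]) auto
next
  case (Suc N)
  interpret grp: group G using group_hom group_hom.axioms(1) by blast
  obtain W where W: "finite W" "W \<subseteq> carrier G" and
    IH: "\<And>F u a. F \<subseteq> E \<Longrightarrow> (\<And>g. g \<in> W \<Longrightarrow> a \<le> (\<Sum>x\<in>F. u (\<phi> g x))) \<Longrightarrow>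
      a \<le> (\<Sum>x\<in>F. (avg T ^^ N) u x)"
    using Suc by metis
  let ?W = "(\<lambda>(t, g). t \<otimes>\<^bsub>G\<^esub> g) ` (T \<times> W)"
  have "a \<le> (\<Sum>x\<in>F. (avg T ^^ Suc N) u x)"
    if F: "F \<subseteq> E" and a: "\<forall>g\<in>?W. a \<le> (\<Sum>x\<in>F. u (\<phi> g x))" for F u a
  proof -
    \<comment> \<open>The induction hypothesis is going to be used with \<open>avg T u\<close> in
      place of \<open>u\<close>; the letter \<open>t\<close> of this average lands on the left of
      the word \<open>g\<close>.\<close>
    have "a \<le> (\<Sum>x\<in>F. avg T u (\<phi> g x))" if g: "g \<in> W" for g
    proof -
      have "a * card T = (\<Sum>t\<in>T. a)" by simp
      also have "\<dots> \<le> (\<Sum>t\<in>T. \<Sum>x\<in>F. u (\<phi> t (\<phi> g x)))"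
      proof (rule sum_mono)
        fix t assume t: "t \<in> T"
        have "(\<Sum>x\<in>F. u (\<phi> (t \<otimes>\<^bsub>G\<^esub> g) x)) = (\<Sum>x\<in>F. u (\<phi> t (\<phi> g x)))"
          using t g T W F by (intro sum.cong refl arg_cong[of _ _ u] composition_rule) auto
        moreover have "t \<otimes>\<^bsub>G\<^esub> g \<in> ?W" using t g by force
        ultimately show "a \<le> (\<Sum>x\<in>F. u (\<phi> t (\<phi> g x)))" using a by metis
      qed
      also have "\<dots> = (\<Sum>x\<in>F. avg T u (\<phi> g x)) * card T"
        using T by (subst sum.swap) (simp add: avg_def sum_divide_distrib[symmetric])
      finally show ?thesis using T by (simp add: card_gt_0_iff)
    qed
    then have "a \<le> (\<Sum>x\<in>F. (avg T ^^ N) (avg T u) x)" by (rule IH[OF F])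
    then show ?thesis by (simp add: funpow_swap1)
  qed
  moreover have "finite ?W" "?W \<subseteq> carrier G" using T W by auto
  ultimately show ?case by (intro exI[of _ ?W] conjI allI impI)
qed

lemma almost_invariant_l2:
  assumes \<epsilon>: "\<epsilon> < 1" and Folner: "\<And>S. finite S \<Longrightarrow> S \<subseteq> carrier G \<Longrightarrow>
      \<exists>F. finite F \<and> F \<noteq> {} \<and> F \<subseteq> E \<and>
        (\<forall>\<gamma>\<in>S. real (card (\<phi> \<gamma> ` F \<inter> F)) / real (card F) > 1 - \<epsilon>)"
    and S: "finite S" "S \<subseteq> carrier G" and \<eta>: "0 < \<eta>"
  obtains w where "finsupp E w" "0 < l2sq E w"
    "\<And>s. s \<in> S \<Longrightarrow> l2sq E (\<lambda>x. w (\<phi> s x) - w x) \<le> \<eta> * l2sq E w"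
proof -
  interpret grp: group G using group_hom group_hom.axioms(1) by blast
  define T where "T = insert \<one>\<^bsub>G\<^esub> S"
  have T: "finite T" "T \<noteq> {}" "T \<subseteq> carrier G" using S by (auto simp: T_def)
  define n where "n = real (card T)"
  have n: "0 < n" using T by (simp add: n_def card_gt_0_iff)
  define c where "c = 1 - \<epsilon>"
  have c: "0 < c" using \<epsilon> by (simp add: c_def)
  \<comment> \<open>In this bound \<open>n\<close> pays for passing from the mean over
    \<open>T\<close> to a single term, \<open>c\<^sup>2\<close> for replacing \<open>b 0\<close> by
    \<open>b m\<close>, and 4 for the final triangle inequality.\<close>
  obtain N where N: "4 * n / (\<eta> * c\<^sup>2) < real N" using reals_Archimedean2 by blast
  have "0 \<le> 4 * n / (\<eta> * c\<^sup>2)" using n c \<eta> by simp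
  with N have N0: "0 < real N" by linarith
  obtain W where W: "finite W" "W \<subseteq> carrier G" and
    low: "\<And>F u a. F \<subseteq> E \<Longrightarrow> (\<And>g. g \<in> W \<Longrightarrow> a \<le> (\<Sum>x\<in>F. u (\<phi> g x))) \<Longrightarrow>
      a \<le> (\<Sum>x\<in>F. (avg T ^^ N) u x)"
    using funpow_avg_lower_bound[OF T, of N] by metis
  obtain F where F: "finite F" "F \<noteq> {}" "F \<subseteq> E"
    and FW: "\<And>g. g \<in> W \<Longrightarrow> real (card (\<phi> g ` F \<inter> F)) / real (card F) > c"
    using Folner[OF W] unfolding c_def by blast
  have F0: "0 < real (card F)" using F by (simp add: card_gt_0_iff)
  define v where "v m = (avg T ^^ m) (indicator F :: 'c \<Rightarrow> real)" for m
  define b where "b m = l2sq E (v m)" for m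
  have v: "finsupp E (v m)" for m
  proof (induction m)
    case 0
    have "{x\<in>E. indicator F x \<noteq> (0::real)} \<subseteq> F" by (auto simp: indicator_def)
    then show ?case using F finite_subset by (auto simp: v_def finsupp_def)
  next
    case (Suc m)
    then show ?case using finsupp_avg[of T "v m"] T by (simp add: v_def)
  qed
  have dev: "(\<Sum>t\<in>T. l2sq E (\<lambda>x. v m (\<phi> t x) - v (Suc m) x)) = n * (b m - b (Suc m))" for m
    using l2sq_avg_deviation[OF T v, of m] by (simp add: v_def b_def n_def)
  have "0 \<le> n * (b m - b (Suc m))" for m
    unfolding dev[symmetric] by (intro sum_nonneg l2sq_nonneg)
  then have step: "b (Suc m) \<le> b m" for m using n by (simp add: zero_le_mult_iff)
  have b0: "b 0 = card F"
  proof -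
    have "b 0 = (\<Sum>\<^sub>\<infinity>x\<in>F. 1)" unfolding b_def l2sq_def v_def
      using F by (intro infsum_cong_neutral) (auto simp: indicator_def)
    then show ?thesis using F by simp
  qed
  \<comment> \<open>The sum of \<open>v N\<close> over \<open>F\<close> is its inner product with
    the indicator function of \<open>F\<close>. Summing \<open>(v N x - c)\<^sup>2 \<ge> 0\<close>
    over \<open>F\<close> turns a lower bound for it into one for the square sum.\<close>
  have bN: "c\<^sup>2 * card F \<le> b N"
  proof -
    have "c * card F \<le> (\<Sum>x\<in>F. v N x)" unfolding v_def
    proof (rule low[OF F(3)])
      fix g assume g: "g \<in> W"
      have "\<phi> g ` F \<inter> F = \<phi> g ` {x\<in>F. \<phi> g x \<in> F}" by auto
      then have "card (\<phi> g ` F \<inter> F) = card {x\<in>F. \<phi> g x \<in> F}"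
        using g W F by (metis (no_types, lifting) act_card mem_Collect_eq subset_iff)
      also have "\<dots> = (\<Sum>x\<in>F. indicator F (\<phi> g x) :: real)"
        using F by (simp add: indicator_def sum.If_cases Int_def)
      finally show "c * card F \<le> (\<Sum>x\<in>F. indicator F (\<phi> g x))"
        using FW[OF g] F0 by (simp add: field_simps)
    qed
    then have "2 * c * (c * card F) \<le> 2 * c * (\<Sum>x\<in>F. v N x)" using c by simp
    then have "c\<^sup>2 * card F \<le> 2 * c * (\<Sum>x\<in>F. v N x) - c\<^sup>2 * card F"
      by (simp add: power2_eq_square)
    also have "\<dots> = (\<Sum>x\<in>F. 2 * c * v N x - c\<^sup>2)"
      by (simp add: sum_subtractf sum_distrib_left)
    also have "\<dots> \<le> (\<Sum>x\<in>F. (v N x)\<^sup>2)"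
    proof (rule sum_mono)
      fix x show "2 * c * v N x - c\<^sup>2 \<le> (v N x)\<^sup>2"
        using zero_le_power2[of "v N x - c"] by (simp add: power2_diff algebra_simps)
    qed
    also have "\<dots> \<le> b N" unfolding b_def by (rule sum_le_l2sq[OF v F(1,3)])
    finally show ?thesis .
  qed
  \<comment> \<open>Pigeonhole: the \<open>N\<close> drops telescope to at most
    \<open>b 0\<close>.\<close>
  have "\<exists>m<N. b m - b (Suc m) \<le> b 0 / N"
  proof (rule ccontr)
    assume "\<not> ?thesis"
    then have "(\<Sum>m<N. b 0 / N) < (\<Sum>m<N. b m - b (Suc m))"
      using N0 by (intro sum_strict_mono) (auto simp: not_le)
    also have "\<dots> = b 0 - b N" by (rule sum_lessThan_telescope')
    finally show False using N0 l2sq_nonneg[of E "v N"] by (simp add: b_def)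
  qed
  then obtain m where m: "m < N" "b m - b (Suc m) \<le> b 0 / N" by blast
  have "b N \<le> b m" using lift_Suc_antimono_le[of b m N] step m by simp
  with bN have bm: "c\<^sup>2 * card F \<le> b m" by linarith
  have bm0: "0 < b m" using bm c F0 by (smt (verit) mult_pos_pos zero_less_power)
  have small: "l2sq E (\<lambda>x. v m (\<phi> t x) - v (Suc m) x) \<le> \<eta> / 4 * b m" if t: "t \<in> T" for t
  proof -
    have "l2sq E (\<lambda>x. v m (\<phi> t x) - v (Suc m) x) \<le> n * (b m - b (Suc m))"
      unfolding dev[symmetric] using T t by (intro member_le_sum l2sq_nonneg) auto
    also have "\<dots> \<le> n * (b 0 / N)" using m n by (intro mult_left_mono) auto
    also have "\<dots> = (n / (N * c\<^sup>2)) * (c\<^sup>2 * card F)" using c by (simp add: b0)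
    also have "\<dots> \<le> \<eta> / 4 * b m"
    proof (rule mult_mono)
      show "n / (N * c\<^sup>2) \<le> \<eta> / 4" using N N0 c \<eta> by (simp add: field_simps)
    qed (use bm \<eta> c in auto)
    finally show ?thesis .
  qed
  \<comment> \<open>As the unit is in \<open>T\<close>, \<open>v m\<close> itself is near its
    average, which then serves as an intermediate point between \<open>v m\<close> and its
    translates.\<close>
  have id: "l2sq E (\<lambda>x. v m x - v (Suc m) x) \<le> \<eta> / 4 * b m"
  proof -
    have "l2sq E (\<lambda>x. v m (\<phi> \<one>\<^bsub>G\<^esub> x) - v (Suc m) x) = l2sq E (\<lambda>x. v m x - v (Suc m) x)"
      unfolding l2sq_def by (intro infsum_cong) (auto simp: id_eq_one[symmetric])
    then show ?thesis using small[of "\<one>\<^bsub>G\<^esub>"] by (simp add: T_def)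
  qed
  have "l2sq E (\<lambda>x. v m (\<phi> s x) - v m x) \<le> \<eta> * b m" if s: "s \<in> S" for s
  proof -
    let ?p = "\<lambda>x. v m (\<phi> s x) - v (Suc m) x" and ?q = "\<lambda>x. v m x - v (Suc m) x"
    have fs: "finsupp E (\<lambda>x. v m (\<phi> s x))" using s S v by (intro finsupp_act) auto
    have fp: "finsupp E ?p" by (rule finsupp_combine[OF fs v[of "Suc m"]]) simp
    have fq: "finsupp E ?q" by (rule finsupp_combine[OF v[of m] v[of "Suc m"]]) simp
    have fpq: "finsupp E (\<lambda>x. v m (\<phi> s x) - v m x)"
      by (rule finsupp_combine[OF fs v[of m]]) simp
    note sp = finsupp_summable[OF finsupp_power2[OF fp]]
      and sq = finsupp_summable[OF finsupp_power2[OF fq]]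
      and spq = finsupp_summable[OF finsupp_power2[OF fpq]]
    have "l2sq E (\<lambda>x. v m (\<phi> s x) - v m x) \<le> (\<Sum>\<^sub>\<infinity>x\<in>E. 2 * (?p x)\<^sup>2 + 2 * (?q x)\<^sup>2)"
      unfolding l2sq_def
    proof (rule infsum_mono[OF spq])
      show "(\<lambda>x. 2 * (?p x)\<^sup>2 + 2 * (?q x)\<^sup>2) summable_on E"
        by (intro summable_on_add summable_on_cmult_right sp sq)
      fix x show "(v m (\<phi> s x) - v m x)\<^sup>2 \<le> 2 * (?p x)\<^sup>2 + 2 * (?q x)\<^sup>2"
        using zero_le_power2[of "?p x + ?q x"] by (simp add: power2_eq_square algebra_simps)
    qed
    also have "\<dots> = 2 * l2sq E ?p + 2 * l2sq E ?q"
      unfolding l2sq_def infsum_cmult_right'[symmetric]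
      by (intro infsum_add summable_on_cmult_right sp sq)
    also have "\<dots> \<le> \<eta> * b m" using small[of s] id s by (simp add: T_def)
    finally show ?thesis .
  qed
  then show ?thesis using that[of "v m"] v bm0 unfolding b_def by blast
qed

text \<open>The density is \<open>w\<^sup>2\<close> divided by its sum, for an almost invariant
  \<open>w\<close>; \<open>abs_diff_power2_le\<close> carries almost invariance over from square
  sums to absolute sums.\<close>

lemma Reiter_if_Folner:
  assumes \<epsilon>: "\<epsilon> < 1" and Folner: "\<And>S. finite S \<Longrightarrow> S \<subseteq> carrier G \<Longrightarrow>
      \<exists>F. finite F \<and> F \<noteq> {} \<and> F \<subseteq> E \<and>
        (\<forall>\<gamma>\<in>S. real (card (\<phi> \<gamma> ` F \<inter> F)) / real (card F) > 1 - \<epsilon>)"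
    and S: "finite S" "S \<subseteq> carrier G" and \<delta>: "0 < \<delta>"
  obtains f where "finsupp E f" "\<And>x. 0 \<le> f x" "infsum f E = 1"
    "\<And>s. s \<in> S \<Longrightarrow> (\<Sum>\<^sub>\<infinity>x\<in>E. \<bar>f (\<phi> s x) - f x\<bar>) \<le> \<delta>"
proof -
  \<comment> \<open>The estimate ends in \<open>5 / 2 * d\<close>: almost invariance at level
    \<open>d\<^sup>2\<close> contributes \<open>d / 2\<close>, and the square sums of
    \<open>w\<close> and its translate contribute \<open>d\<close> each.\<close>
  define d where "d = \<delta> / 3"
  have d: "0 < d" using \<delta> by (simp add: d_def)
  obtain w where w: "finsupp E w" "0 < l2sq E w"
    and ws: "\<And>s. s \<in> S \<Longrightarrow> l2sq E (\<lambda>x. w (\<phi> s x) - w x) \<le> d\<^sup>2 * l2sq E w"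
    using almost_invariant_l2[OF \<epsilon> Folner S, of "d\<^sup>2"] d by auto
  define L where "L = l2sq E w"
  have L: "0 < L" using w by (simp add: L_def)
  define f where "f x = inverse L * (w x)\<^sup>2" for x
  have ff: "finsupp E f" by (rule finsupp_mono[OF w(1)]) (simp add: f_def)
  have one: "infsum f E = 1"
    unfolding f_def infsum_cmult_right' using L by (simp add: L_def l2sq_def)
  have "(\<Sum>\<^sub>\<infinity>x\<in>E. \<bar>f (\<phi> s x) - f x\<bar>) \<le> \<delta>" if s: "s \<in> S" for s
  proof -
    let ?a = "\<lambda>x. w (\<phi> s x)"
    have sc: "s \<in> carrier G" using s S by blast
    have fa: "finsupp E ?a" using w sc by (intro finsupp_act)
    have fd: "finsupp E (\<lambda>x. ?a x - w x)" by (rule finsupp_combine[OF fa w(1)]) simp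
    have fl: "finsupp E (\<lambda>x. \<bar>f (\<phi> s x) - f x\<bar>)"
      by (rule finsupp_combine[OF fa w(1)]) (simp add: f_def)
    note sa = finsupp_summable[OF finsupp_power2[OF fa]]
      and sd = finsupp_summable[OF finsupp_power2[OF fd]]
      and sw = finsupp_summable[OF finsupp_power2[OF w(1)]]
    let ?B = "\<lambda>x. inverse (2 * d) * (?a x - w x)\<^sup>2 + (d * (?a x)\<^sup>2 + d * (w x)\<^sup>2)"
    have "(\<Sum>\<^sub>\<infinity>x\<in>E. \<bar>f (\<phi> s x) - f x\<bar>) \<le> (\<Sum>\<^sub>\<infinity>x\<in>E. inverse L * ?B x)"
    proof (rule infsum_mono[OF finsupp_summable[OF fl]])
      show "(\<lambda>x. inverse L * ?B x) summable_on E"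
        by (intro summable_on_add summable_on_cmult_right sa sd sw)
      fix x
      have "\<bar>f (\<phi> s x) - f x\<bar> = inverse L * \<bar>(?a x)\<^sup>2 - (w x)\<^sup>2\<bar>"
        using L by (simp add: f_def right_diff_distrib[symmetric] abs_mult)
      also have "\<dots> \<le> inverse L * ?B x" using L by (intro mult_left_mono abs_diff_power2_le d) auto
      finally show "\<bar>f (\<phi> s x) - f x\<bar> \<le> inverse L * ?B x" .
    qed
    also have "\<dots> = inverse L * (inverse (2 * d) * l2sq E (\<lambda>x. ?a x - w x)
        + (d * l2sq E ?a + d * l2sq E w))"
    proof -
      have "(\<Sum>\<^sub>\<infinity>x\<in>E. k * (?a x - w x)\<^sup>2 + (d * (?a x)\<^sup>2 + d * (w x)\<^sup>2))
          = k * l2sq E (\<lambda>x. ?a x - w x) + (d * l2sq E ?a + d * l2sq E w)" for k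
        unfolding l2sq_def
        by (simp add: infsum_cmult_right' infsum_add summable_on_add summable_on_cmult_right sa sd sw)
      then show ?thesis by (simp only: infsum_cmult_right')
    qed
    also have "l2sq E ?a = L" unfolding L_def by (rule l2sq_reindex[OF act_bij[OF sc]])
    also have "inverse L * (inverse (2 * d) * l2sq E (\<lambda>x. ?a x - w x) + (d * L + d * l2sq E w))
        \<le> inverse L * (inverse (2 * d) * (d\<^sup>2 * L) + (d * L + d * L))"
      using ws[OF s] L d by (intro mult_left_mono add_mono) (auto simp: L_def)
    also have "\<dots> = 5 / 2 * d" using L d by (simp add: field_simps power2_eq_square)
    also have "\<dots> \<le> \<delta>" using \<delta> by (simp add: d_def)
    finally show ?thesis .
  qed
  then show ?thesis using that[OF ff _ one] L by (simp add: f_def)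
qed
end

section \<open>From almost invariant densities to an invariant mean, by compactness\<close>

lemma abs_infsum_finsupp_le:
  assumes h: "finsupp E h" and u: "finsupp E u" and le: "\<And>x. x \<in> E \<Longrightarrow> \<bar>h x\<bar> \<le> u x"
  shows "\<bar>infsum h E\<bar> \<le> infsum u E"
proof -
  note sh = finsupp_summable[OF h] and su = finsupp_summable[OF u]
  have "infsum h E \<le> infsum u E"
    by (rule infsum_mono[OF sh su]) (use le in force)
  moreover have "(\<Sum>\<^sub>\<infinity>x\<in>E. - h x) \<le> infsum u E"
    by (rule infsum_mono[OF iffD2[OF summable_on_uminus sh] su]) (use le in force)
  ultimately show ?thesis by (simp add: infsum_uminus)
qed

context group_action begin

lemma translate_in_ell_infty:
  assumes \<gamma>: "\<gamma> \<in> carrier G" and f: "f \<in> ell_infty E"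
  shows "translate G E \<phi> \<gamma> f \<in> ell_infty E"
proof -
  interpret grp: group G using group_hom group_hom.axioms(1) by blast
  have "translate G E \<phi> \<gamma> f ` E \<subseteq> f ` E"
    using \<gamma> by (auto simp: translate_def act_closed)
  then show ?thesis
    using f bounded_subset unfolding ell_infty_def by (auto simp: translate_def)
qed

text \<open>By Tychonoff, functionals bounded by the sup norm lie in a compact product of intervals.
  Being a mean and being almost invariant are closed conditions there, so the finite intersection
  property gives one mean for all group elements and tolerances.\<close>

lemma amenable_if_Reiter:
  assumes Reiter: "\<And>S \<delta>. finite S \<Longrightarrow> S \<subseteq> carrier G \<Longrightarrow> 0 < \<delta> \<Longrightarrow>
    \<exists>f. finsupp E f \<and> (\<forall>x. 0 \<le> f x) \<and> infsum f E = 1 \<and>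
      (\<forall>s\<in>S. (\<Sum>\<^sub>\<infinity>x\<in>E. \<bar>f (\<phi> s x) - f x\<bar>) \<le> \<delta>)"
  shows "amenable_action G E \<phi>"
proof -
  interpret grp: group G using group_hom group_hom.axioms(1) by blast
  define B where "B g = (SUP x\<in>E. \<bar>g x\<bar>)" for g :: "'c \<Rightarrow> real"
  have B: "\<bar>g x\<bar> \<le> \<bar>B g\<bar>" if "g \<in> ell_infty E" "x \<in> E" for g x
  proof -
    have "bdd_above ((\<lambda>x. \<bar>g x\<bar>) ` E)"
      using that by (auto simp: ell_infty_def bounded_iff bdd_above_def)
    then have "\<bar>g x\<bar> \<le> B g" unfolding B_def using that by (intro cSUP_upper)
    then show ?thesis by linarith
  qed
  \<comment> \<open>The product runs over all functions. Where \<open>B g\<close> is not a genuine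
    supremum, the absolute value still makes the interval contain 0, the default value of
    \<open>m\<close> below.\<close>
  define K where "K = (\<Pi>\<^sub>E g\<in>UNIV. {- \<bar>B g\<bar>..\<bar>B g\<bar>})"
  have K: "compact K"
  proof -
    have "compactin (product_topology (\<lambda>g. euclidean) UNIV) K"
      unfolding K_def by (subst compactin_PiE) (auto simp: compactin_euclidean_iff)
    then show ?thesis by (simp add: euclidean_product_topology compactin_euclidean_iff)
  qed
  define Mean where "Mean = {m. linear_functional_on_ell_infty E m \<and> m (\<lambda>x\<in>E. 1) = 1 \<and>
    (\<forall>f\<in>ell_infty E. (\<forall>x\<in>E. 0 \<le> f x) \<longrightarrow> 0 \<le> m f)}"
  define Inv where "Inv = (\<lambda>(\<gamma>, \<delta>). {m. \<forall>g\<in>ell_infty E.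
    \<bar>m (translate G E \<phi> \<gamma> g) - m g\<bar> \<le> \<delta> * \<bar>B g\<bar>})"
  \<comment> \<open>Each condition compares finitely many coordinates of \<open>m\<close>, and
    coordinates are continuous in the product topology.\<close>
  have cl_Mean: "closed Mean"
    unfolding Mean_def linear_functional_on_ell_infty_def Ball_def
    by (intro closed_Collect_conj closed_Collect_all closed_Collect_imp open_Collect_const
        closed_Collect_eq closed_Collect_le continuous_intros continuous_on_product_coordinates)
  have cl_Inv: "closed (Inv p)" for p
    unfolding Inv_def Ball_def case_prod_unfold
    by (intro closed_Collect_all closed_Collect_imp open_Collect_const
        closed_Collect_le continuous_intros continuous_on_product_coordinates)
  have "K \<inter> (\<Inter>p\<in>carrier G \<times> {0<..}. Mean \<inter> Inv p) \<noteq> {}"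
  proof (rule compact_imp_fip_image[OF K])
    fix I :: "('a \<times> real) set" assume I: "finite I" "I \<subseteq> carrier G \<times> {0<..}"
    \<comment> \<open>\<open>translate\<close> precomposes with the inverse, hence the inverses
      here. The 1 inserted into the next minimum covers the case of empty \<open>I\<close>.\<close>
    define S where "S = (\<lambda>p. inv\<^bsub>G\<^esub> (fst p)) ` I"
    define \<delta> where "\<delta> = Min (insert 1 (snd ` I))"
    have \<delta>: "0 < \<delta>" "\<And>p. p \<in> I \<Longrightarrow> \<delta> \<le> snd p"
      using I by (auto simp: \<delta>_def intro!: Min_le)
    have "finite S" "S \<subseteq> carrier G" using I by (auto simp: S_def)
    then obtain f where f: "finsupp E f" "\<And>x. 0 \<le> f x" "infsum f E = 1"
      and fS: "\<And>s. s \<in> S \<Longrightarrow> (\<Sum>\<^sub>\<infinity>x\<in>E. \<bar>f (\<phi> s x) - f x\<bar>) \<le> \<delta>"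
      using Reiter \<delta>(1) by metis
    define m where "m g = (if g \<in> ell_infty E then \<Sum>\<^sub>\<infinity>x\<in>E. f x * g x else 0)" for g
    have fin: "finsupp E (\<lambda>x. f x * g x)" for g by (rule finsupp_mono[OF f(1)]) simp
    have closure: "(\<lambda>x\<in>E. g x + h x) \<in> ell_infty E" "(\<lambda>x\<in>E. c * g x) \<in> ell_infty E"
      if "g \<in> ell_infty E" "h \<in> ell_infty E" for g h c
    proof -
      show "(\<lambda>x\<in>E. g x + h x) \<in> ell_infty E" unfolding ell_infty_def
      proof (intro CollectI conjI boundedI[of _ "\<bar>B g\<bar> + \<bar>B h\<bar>"])
        fix y assume "y \<in> (\<lambda>x\<in>E. g x + h x) ` E"
        then obtain x where "x \<in> E" "y = g x + h x" by auto
        then show "norm y \<le> \<bar>B g\<bar> + \<bar>B h\<bar>" using B[of g x] B[of h x] that by auto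
      qed auto
      show "(\<lambda>x\<in>E. c * g x) \<in> ell_infty E" unfolding ell_infty_def
      proof (intro CollectI conjI boundedI[of _ "\<bar>c\<bar> * \<bar>B g\<bar>"])
        fix y assume "y \<in> (\<lambda>x\<in>E. c * g x) ` E"
        then obtain x where "x \<in> E" "y = c * g x" by auto
        then show "norm y \<le> \<bar>c\<bar> * \<bar>B g\<bar>" using B[of g x] that
          by (auto simp: abs_mult mult_left_mono)
      qed auto
    qed
    have one: "(\<lambda>x\<in>E. 1) \<in> ell_infty E"
      unfolding ell_infty_def by (auto intro!: boundedI[of _ 1])
    have add: "m (\<lambda>x\<in>E. g x + h x) = m g + m h" if "g \<in> ell_infty E" "h \<in> ell_infty E" for g h
    proof -
      have "m (\<lambda>x\<in>E. g x + h x) = (\<Sum>\<^sub>\<infinity>x\<in>E. f x * g x + f x * h x)"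
        using closure(1)[OF that] by (auto simp: m_def distrib_left intro!: infsum_cong)
      also have "\<dots> = m g + m h"
        using that by (simp add: m_def infsum_add finsupp_summable[OF fin])
      finally show ?thesis .
    qed
    have scale: "m (\<lambda>x\<in>E. c * g x) = c * m g" if "g \<in> ell_infty E" for g c
    proof -
      have "m (\<lambda>x\<in>E. c * g x) = (\<Sum>\<^sub>\<infinity>x\<in>E. c * (f x * g x))"
        using closure(2)[OF that that] by (auto simp: m_def mult_ac intro!: infsum_cong)
      also have "\<dots> = c * m g" using that by (simp add: m_def infsum_cmult_right')
      finally show ?thesis .
    qed
    have m1: "m (\<lambda>x\<in>E. 1) = 1"
    proof -
      have "m (\<lambda>x\<in>E. 1) = infsum f E" using one by (auto simp: m_def intro!: infsum_cong)
      then show ?thesis using f by simp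
    qed
    have "m \<in> Mean"
      unfolding Mean_def linear_functional_on_ell_infty_def
      using add scale m1 f(2) by (auto simp: m_def intro!: infsum_nonneg)
    moreover have "m \<in> K"
    proof -
      have "\<bar>m g\<bar> \<le> \<bar>B g\<bar>" for g
      proof (cases "g \<in> ell_infty E")
        case True
        have "\<bar>\<Sum>\<^sub>\<infinity>x\<in>E. f x * g x\<bar> \<le> (\<Sum>\<^sub>\<infinity>x\<in>E. f x * \<bar>B g\<bar>)"
          using B[OF True] f(2)
          by (intro abs_infsum_finsupp_le fin) (auto simp: abs_mult mult_left_mono)
        also have "\<dots> = \<bar>B g\<bar>" using f(3) by (simp add: infsum_cmult_left')
        finally show ?thesis using True by (simp add: m_def)
      qed (simp add: m_def)
      then show ?thesis by (auto simp: K_def abs_le_iff minus_le_iff)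
    qed
    moreover have "m \<in> Inv p" if p: "p \<in> I" for p
    proof -
      obtain \<gamma> d where pd: "p = (\<gamma>, d)" by fastforce
      have \<gamma>: "\<gamma> \<in> carrier G" and d: "\<delta> \<le> d" using p I \<delta>(2)[OF p] by (auto simp: pd)
      let ?s = "inv\<^bsub>G\<^esub> \<gamma>"
      have s: "?s \<in> carrier G" "?s \<in> S" using \<gamma> p by (force simp: S_def pd)+
      have fd: "finsupp E (\<lambda>x. f (\<phi> ?s x) - f x)"
        by (rule finsupp_combine[OF finsupp_act[OF s(1) f(1)] f(1)]) simp
      have "\<bar>m (translate G E \<phi> \<gamma> g) - m g\<bar> \<le> d * \<bar>B g\<bar>" if g: "g \<in> ell_infty E" for g
      proof -
        let ?g = "\<lambda>x. g (\<phi> ?s x)"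
        have fs: "finsupp E (\<lambda>x. f (\<phi> ?s x) * ?g x)"
          by (rule finsupp_mono[OF finsupp_act[OF s(1) f(1)]]) simp
        have fdg: "finsupp E (\<lambda>x. (f (\<phi> ?s x) - f x) * ?g x)"
          by (rule finsupp_mono[OF fd]) simp
        have "m (translate G E \<phi> \<gamma> g) = (\<Sum>\<^sub>\<infinity>x\<in>E. f x * ?g x)"
          using translate_in_ell_infty[OF \<gamma> g]
          by (auto simp: m_def translate_def intro!: infsum_cong)
        \<comment> \<open>Substituting \<open>\<phi> ?s x\<close> for \<open>x\<close> puts the same
          factor \<open>?g\<close> into both sums, so their difference involves only the change of
          the density.\<close>
        moreover have "m g = (\<Sum>\<^sub>\<infinity>x\<in>E. f (\<phi> ?s x) * ?g x)"
          using g infsum_reindex_bij_betw[OF act_bij[OF s(1)], of "\<lambda>x. f x * g x"]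
          by (simp add: m_def)
        moreover have "(\<Sum>\<^sub>\<infinity>x\<in>E. f (\<phi> ?s x) * ?g x)
            = (\<Sum>\<^sub>\<infinity>x\<in>E. (f (\<phi> ?s x) - f x) * ?g x) + (\<Sum>\<^sub>\<infinity>x\<in>E. f x * ?g x)"
          using infsum_add[OF finsupp_summable[OF fdg] finsupp_summable[OF fin[of ?g]]]
          by (simp add: left_diff_distrib)
        ultimately have "\<bar>m (translate G E \<phi> \<gamma> g) - m g\<bar> = \<bar>\<Sum>\<^sub>\<infinity>x\<in>E. (f (\<phi> ?s x) - f x) * ?g x\<bar>"
          by linarith
        also have "\<dots> \<le> (\<Sum>\<^sub>\<infinity>x\<in>E. \<bar>f (\<phi> ?s x) - f x\<bar> * \<bar>B g\<bar>)"
        proof (rule abs_infsum_finsupp_le[OF fdg])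
          show "finsupp E (\<lambda>x. \<bar>f (\<phi> ?s x) - f x\<bar> * \<bar>B g\<bar>)"
            by (rule finsupp_mono[OF fd]) simp
          fix x assume "x \<in> E"
          then show "\<bar>(f (\<phi> ?s x) - f x) * ?g x\<bar> \<le> \<bar>f (\<phi> ?s x) - f x\<bar> * \<bar>B g\<bar>"
            using B[OF g act_closed[OF s(1)]] by (auto simp: abs_mult intro!: mult_left_mono)
        qed
        also have "\<dots> = (\<Sum>\<^sub>\<infinity>x\<in>E. \<bar>f (\<phi> ?s x) - f x\<bar>) * \<bar>B g\<bar>"
          by (rule infsum_cmult_left')
        also have "\<dots> \<le> d * \<bar>B g\<bar>" using fS[OF s(2)] d by (intro mult_right_mono) auto
        finally show ?thesis .
      qed
      then show ?thesis by (simp add: Inv_def pd)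
    qed
    ultimately show "K \<inter> (\<Inter>p\<in>I. Mean \<inter> Inv p) \<noteq> {}" by blast
  qed (intro closed_Int cl_Mean cl_Inv)
  then obtain m where m: "\<And>p. p \<in> carrier G \<times> {0<..} \<Longrightarrow> m \<in> Mean \<inter> Inv p" by blast
  have "m \<in> Mean" using m[of "(\<one>\<^bsub>G\<^esub>, 1)"] by simp
  moreover have "m (translate G E \<phi> \<gamma> g) = m g" if \<gamma>: "\<gamma> \<in> carrier G" and g: "g \<in> ell_infty E" for \<gamma> g
  proof -
    have *: "\<bar>m (translate G E \<phi> \<gamma> g) - m g\<bar> \<le> d * \<bar>B g\<bar>" if "0 < d" for d
      using m[of "(\<gamma>, d)"] that \<gamma> g by (auto simp: Inv_def)
    \<comment> \<open>The tolerance tends to 0; adding 1 to \<open>\<bar>B g\<bar>\<close> keeps the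
      divisor positive.\<close>
    have "\<bar>m (translate G E \<phi> \<gamma> g) - m g\<bar> \<le> 0 + e" if "0 < e" for e
    proof -
      have "e / (\<bar>B g\<bar> + 1) * \<bar>B g\<bar> \<le> e" using that by (simp add: field_simps)
      then show ?thesis using *[of "e / (\<bar>B g\<bar> + 1)"] that by force
    qed
    then have "\<bar>m (translate G E \<phi> \<gamma> g) - m g\<bar> \<le> 0" by (rule field_le_epsilon)
    then show ?thesis by simp
  qed
  ultimately show ?thesis unfolding amenable_action_def Mean_def by blast
qed
end

theorem theorem5p4:
  fixes G :: "('g, 'r) monoid_scheme" and X :: "'x set" and \<phi> :: "'g \<Rightarrow> 'x \<Rightarrow> 'x"
  assumes "group_action G X \<phi>" and "countable (carrier G)"
  shows "amenable_action G X \<phi> \<longleftrightarrow>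
    (\<exists>\<epsilon>::real. 0 < \<epsilon> \<and> \<epsilon> < 1 \<and>
      (\<forall>S. finite S \<and> S \<subseteq> carrier G \<longrightarrow>
        (\<exists>F. finite F \<and> F \<noteq> {} \<and> F \<subseteq> X \<and>
          (\<forall>\<gamma>\<in>S. real (card (\<phi> \<gamma> ` F \<inter> F)) / real (card F) > 1 - \<epsilon>))))"
    (is "_ \<longleftrightarrow> (\<exists>\<epsilon>. 0 < \<epsilon> \<and> \<epsilon> < 1 \<and> ?Folner \<epsilon>)")
proof
  interpret group_action G X \<phi> by fact
  assume "amenable_action G X \<phi>"
  then have "?Folner (1 / 2)" using Folner_if_amenable by fastforce
  then show "\<exists>\<epsilon>. 0 < \<epsilon> \<and> \<epsilon> < 1 \<and> ?Folner \<epsilon>" by (intro exI[of _ "1 / 2"]) simp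
next
  interpret group_action G X \<phi> by fact
  assume "\<exists>\<epsilon>. 0 < \<epsilon> \<and> \<epsilon> < 1 \<and> ?Folner \<epsilon>"
  then obtain \<epsilon> where \<epsilon>: "\<epsilon> < 1" and Folner: "?Folner \<epsilon>" by blast
  show "amenable_action G X \<phi>"
  proof (rule amenable_if_Reiter)
    fix S and \<delta> :: real assume "finite S" "S \<subseteq> carrier G" "0 < \<delta>"
    then obtain f where "finsupp X f" "\<And>x. 0 \<le> f x" "infsum f X = 1"
      "\<And>s. s \<in> S \<Longrightarrow> (\<Sum>\<^sub>\<infinity>x\<in>X. \<bar>f (\<phi> s x) - f x\<bar>) \<le> \<delta>"
      using Reiter_if_Folner[OF \<epsilon>, of S \<delta>] Folner by blast
    then show "\<exists>f. finsupp X f \<and> (\<forall>x. 0 \<le> f x) \<and> infsum f X = 1 \<and>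
        (\<forall>s\<in>S. (\<Sum>\<^sub>\<infinity>x\<in>X. \<bar>f (\<phi> s x) - f x\<bar>) \<le> \<delta>)"
      by blast
  qed
qed

end
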